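(* Let $\lambda$ be a partition and $n$ a positive integer. There is an explicit bijection between $M(\lambda,n)$ and $SSYT(\lambda,n)$.
   Context: A partition $\lambda=[\lambda_1,\ldots,\lambda_k]$ is a weakly decreasing sequence of positive integers; its frequency representation is $[a_1,\ldots,a_{\lambda_1}]$ with $a_i$ the number of parts equal to $i$. $SSYT(\lambda,n)$ is the set of semistandard Young tableaux of shape $\lambda$ (fillings of the Young diagram with positive integers, rows weakly increasing, columns strictly increasing) with entries at most $n$. A sign matrix is a matrix with entries in $\{-1,0,1\}$ whose column partial sums from the top lie in $\{0,1\}$ and whose row partial sums from the left are nonnegative. $M(\lambda,n)$ is the set of $\lambda_1\times n$ sign matrices whose $i$-th row has total sum $a_{\lambda_1-i+1}$ for all $1\le i\le\lambda_1$. *)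

theory Defs
  imports "Jordan_Normal_Form.Matrix"
begin

definition is_partition :: "nat list \<Rightarrow> bool" where
  "is_partition la \<longleftrightarrow> sorted_wrt (\<ge>) la \<and> (\<forall>p\<in>set la. 0 < p)"

text \<open>The empty sequence counts as a partition, with largest part 0.\<close>

definition largest_part :: "nat list \<Rightarrow> nat" where
  "largest_part la = (case la of [] \<Rightarrow> 0 | p # _ \<Rightarrow> p)"

definition frequency :: "nat list \<Rightarrow> nat \<Rightarrow> nat" where
  "frequency la i = count_list la i"

text \<open>A tableau is the list of its rows, from top to bottom.\<close>

definition SSYT :: "nat list \<Rightarrow> nat \<Rightarrow> nat list list set" where
  "SSYT la n = {T. map length T = la
     \<and> (\<forall>row\<in>set T. set row \<subseteq> {1..n})
     \<and> (\<forall>row\<in>set T. sorted_wrt (\<le>) row)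
     \<and> (\<forall>r r' c. r < r' \<longrightarrow> r' < length T \<longrightarrow> c < length (T ! r') \<longrightarrow> T ! r ! c < T ! r' ! c)}"

definition sign_matrix :: "int mat \<Rightarrow> bool" where
  "sign_matrix A \<longleftrightarrow>
     (\<forall>i<dim_row A. \<forall>j<dim_col A. A $$ (i, j) \<in> {-1, 0, 1})
     \<and> (\<forall>i<dim_row A. \<forall>j<dim_col A. (\<Sum>k\<le>i. A $$ (k, j)) \<in> {0, 1})
     \<and> (\<forall>i<dim_row A. \<forall>j<dim_col A. 0 \<le> (\<Sum>k\<le>j. A $$ (i, k)))"

text \<open>Matrix indices start at 0, so the row with index \<open>i\<close> is the \<open>(i + 1)\<close>-st row, and its
  prescribed total is the number of parts equal to \<open>largest_part la - (i + 1) + 1\<close>.\<close>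

definition sign_matrices :: "nat list \<Rightarrow> nat \<Rightarrow> int mat set" where
  "sign_matrices la n = {A \<in> carrier_mat (largest_part la) n. sign_matrix A
     \<and> (\<forall>i<largest_part la. (\<Sum>j<n. A $$ (i, j)) = int (frequency la (largest_part la - i)))}"

text \<open>The explicit bijection. Counting rows and columns from 1, the entries of column
  \<open>largest_part la - i + 1\<close> of the tableau are the positions of the matrix columns whose first
  \<open>i\<close> entries sum to 1, listed increasingly from top to bottom. Below, the tableau column \<open>c\<close>
  and the matrix indices start at 0, while the tableau entries \<open>Suc j\<close> start at 1.\<close>

definition tableau_column :: "nat list \<Rightarrow> nat \<Rightarrow> int mat \<Rightarrow> nat \<Rightarrow> nat list" where
  "tableau_column la n A c =
     sorted_list_of_set {Suc j |j. j < n \<and> (\<Sum>k<largest_part la - c. A $$ (k, j)) = 1}"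

definition tableau_of_sign_matrix :: "nat list \<Rightarrow> nat \<Rightarrow> int mat \<Rightarrow> nat list list" where
  "tableau_of_sign_matrix la n A =
     map (\<lambda>r. map (\<lambda>c. tableau_column la n A c ! r) [0..<la ! r]) [0..<length la]"

end

theory Submission imports Defs begin

text \<open>A sign matrix is determined by its column partial sums, that is, by the sets \<open>X\<^sub>m\<close> of those
  columns whose first \<open>m\<close> entries sum to 1. The row totals prescribe the cardinalities of the
  \<open>X\<^sub>m\<close>, which are the column lengths of the Young diagram, and nonnegativity of the row partial
  sums says that \<open>X\<^sub>m\<close> has at most as many elements below any bound as the next set \<open>X\<^sub>m\<^sub>+\<^sub>1\<close>.
  Listing the sets increasingly, the latter is entrywise comparison of adjacent columns, hence
  weak increase along the rows of the tableau.\<close>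

section \<open>Sorted lists and counting below a bound\<close>

text \<open>Such a set is an initial segment: a member \<open>r\<close> brings \<open>Suc r\<close>
  members with it, and if \<open>r\<close> is missing at most \<open>r\<close> members remain. This
  turns index sets into cardinalities, both for sorted lists and for the rows that reach a given
  column.\<close>

lemma downward_closed_mem_iff_less_card:
  fixes D :: "nat set"
  assumes "finite D" and "\<And>r s. r \<in> D \<Longrightarrow> s < r \<Longrightarrow> s \<in> D"
  shows "r \<in> D \<longleftrightarrow> r < card D"
proof
  assume "r \<in> D"
  then have "{..r} \<subseteq> D" using assms(2) by (auto simp: le_less)
  from card_mono[OF assms(1) this] show "r < card D" by simp
next
  assume r: "r < card D"
  show "r \<in> D"
  proof (rule ccontr)
    assume "r \<notin> D"
    then have "D \<subseteq> {..<r}" using assms(2) by (metis lessThan_iff linorder_neqE_nat subsetI)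
    from card_mono[OF _ this] r show False by simp
  qed
qed

text \<open>The list is strictly increasing, so the indices of entries up to \<open>x\<close> form
  an initial segment, and indexing maps that segment bijectively onto
  \<open>X \<inter> {..x}\<close>. Bounding an entry thus becomes counting.\<close>

lemma sorted_list_of_set_nth_le_iff:
  fixes X :: "nat set"
  assumes "finite X" and r: "r < card X"
  shows "sorted_list_of_set X ! r \<le> x \<longleftrightarrow> r < card (X \<inter> {..x})"
proof -
  let ?xs = "sorted_list_of_set X"
  let ?D = "{s. s < card X \<and> ?xs ! s \<le> x}"
  have len: "length ?xs = card X" and set: "set ?xs = X" using assms by auto
  have sorted: "?xs ! s < ?xs ! t" if "s < t" "t < card X" for s t
    using that strict_sorted_list_of_set[of X] len by (simp add: sorted_wrt_iff_nth_less)
  have "X \<inter> {..x} = (!) ?xs ` ?D"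
    using set len by (auto simp: set_conv_nth image_iff)
  moreover have "inj_on ((!) ?xs) ?D"
    using distinct_sorted_list_of_set[of X] len by (auto simp: inj_on_def nth_eq_iff_index_eq)
  ultimately have "card (X \<inter> {..x}) = card ?D" by (simp add: card_image)
  moreover have "r \<in> ?D \<longleftrightarrow> r < card ?D"
    by (rule downward_closed_mem_iff_less_card) (auto dest: sorted)
  ultimately show ?thesis using r by auto
qed

lemma sorted_list_of_set_dominance:
  fixes X Y :: "nat set"
  assumes "finite X" "finite Y" and le: "card Y \<le> card X"
  shows "(\<forall>r<card Y. sorted_list_of_set X ! r \<le> sorted_list_of_set Y ! r)
    \<longleftrightarrow> (\<forall>x. card (Y \<inter> {..x}) \<le> card (X \<inter> {..x}))" (is "?L \<longleftrightarrow> ?R")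
proof
  assume L: ?L
  show ?R
  proof (intro allI leI notI)
    fix x
    \<comment> \<open>If the counts fail at \<open>x\<close>, this index separates the lists: the
      entry of \<open>Y\<close> there is still at most \<open>x\<close>, while the entry of
      \<open>X\<close> already exceeds \<open>x\<close>. It is a valid index for both lists because
      \<open>card Y \<le> card X\<close>.\<close>
    let ?r = "card (X \<inter> {..x})"
    assume less: "?r < card (Y \<inter> {..x})"
    then have r: "?r < card Y"
      using card_mono[OF assms(2) Int_lower1, of "{..x}"] by linarith
    have "sorted_list_of_set Y ! ?r \<le> x"
      using sorted_list_of_set_nth_le_iff[OF assms(2) r] less by blast
    then have "sorted_list_of_set X ! ?r \<le> x" using L r by (meson order_trans)
    then show False
      using sorted_list_of_set_nth_le_iff[OF assms(1), of ?r x] r le by simp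
  qed
next
  assume R: ?R
  show ?L
  proof (intro allI impI)
    fix r assume r: "r < card Y"
    \<comment> \<open>The counts need comparing only at the \<open>r\<close>-th entry of
      \<open>Y\<close> itself, up to which \<open>Y\<close> has more than \<open>r\<close>
      elements.\<close>
    let ?x = "sorted_list_of_set Y ! r"
    have "r < card (Y \<inter> {..?x})"
      using sorted_list_of_set_nth_le_iff[OF assms(2) r] by blast
    then have "r < card (X \<inter> {..?x})" using R by (meson order_less_le_trans)
    then show "sorted_list_of_set X ! r \<le> ?x"
      using sorted_list_of_set_nth_le_iff[OF assms(1), of r] r le by simp
  qed
qed

text \<open>Links counts below a bound with sums over the first \<open>j\<close> matrix columns.
  Column \<open>k\<close> stands for the number \<open>Suc k\<close>, hence 0 has to be
  excluded.\<close>

lemma card_Int_atMost_eq_sum: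
  assumes "0 \<notin> X"
  shows "int (card (X \<inter> {..j})) = (\<Sum>k<j. of_bool (Suc k \<in> X))"
proof (induction j)
  case 0
  have "X \<inter> {..0} = {}" using assms by auto
  then show ?case by simp
next
  case (Suc j)
  have "X \<inter> {..Suc j} = (if Suc j \<in> X then insert (Suc j) (X \<inter> {..j}) else X \<inter> {..j})"
    by (auto simp: le_Suc_eq)
  then show ?case using Suc by simp
qed

section \<open>Column lengths of the Young diagram\<close>

text \<open>These are the parts of the conjugate partition, with columns numbered from 0.\<close>

definition column_length :: "nat list \<Rightarrow> nat \<Rightarrow> nat" where
  "column_length la c = card {r. r < length la \<and> c < la ! r}"

lemma column_length_eq_filter: "column_length la c = length (filter (\<lambda>p. c < p) la)"
  by (simp add: column_length_def length_filter_conv_card)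

text \<open>Parts larger than \<open>c\<close> either exceed \<open>Suc c\<close> or equal it. Hence
  the prescribed row totals are the differences of successive column lengths.\<close>

lemma column_length_Suc:
  "column_length la c = column_length la (Suc c) + frequency la (Suc c)"
  by (induction la) (auto simp: column_length_eq_filter frequency_def)

text \<open>Since the parts decrease weakly, the rows that reach column \<open>c\<close> form an
  initial segment.\<close>

lemma less_nth_iff_less_column_length:
  assumes "is_partition la" and "r < length la"
  shows "c < la ! r \<longleftrightarrow> r < column_length la c"
proof -
  let ?D = "{r. r < length la \<and> c < la ! r}"
  have "la ! t \<le> la ! s" if "s < t" "t < length la" for s t
    using assms(1) that by (auto simp: is_partition_def sorted_wrt_iff_nth_less)
  then have "r \<in> ?D \<longleftrightarrow> r < card ?D"
    by (intro downward_closed_mem_iff_less_card) (auto intro: less_le_trans)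
  then show ?thesis using assms(2) by (simp add: column_length_def)
qed

lemma column_length_le: "column_length la c \<le> length la"
  by (simp add: column_length_eq_filter)

lemma part_le_largest_part: "is_partition la \<Longrightarrow> p \<in> set la \<Longrightarrow> p \<le> largest_part la"
  by (cases la) (auto simp: is_partition_def largest_part_def)

lemma column_length_largest_part: "is_partition la \<Longrightarrow> column_length la (largest_part la) = 0"
  using part_le_largest_part by (fastforce simp: column_length_eq_filter filter_empty_conv)

section \<open>Sign matrices as chains of sets\<close>

text \<open>Matrix columns are numbered from 1 here, so that the elements can serve directly as
  tableau entries.\<close>

definition partial_sum_support :: "nat \<Rightarrow> int mat \<Rightarrow> nat \<Rightarrow> nat set" where
  "partial_sum_support n A m = {Suc j |j. j < n \<and> (\<Sum>k<m. A $$ (k, j)) = 1}"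

text \<open>Only the values at \<open>m \<le> largest_part la\<close> are constrained, so one chain
  is represented by many functions, and chains are compared on this range only.\<close>

definition dominance_chains :: "nat list \<Rightarrow> nat \<Rightarrow> (nat \<Rightarrow> nat set) set" where
  "dominance_chains la n = {X.
     (\<forall>m\<le>largest_part la. X m \<subseteq> {1..n} \<and> card (X m) = column_length la (largest_part la - m))
     \<and> (\<forall>m<largest_part la. \<forall>x. card (X m \<inter> {..x}) \<le> card (X (Suc m) \<inter> {..x}))}"

text \<open>Each entry is the difference of two successive indicators, which undoes the formation of
  column partial sums.\<close>

definition matrix_of_chain :: "nat \<Rightarrow> nat \<Rightarrow> (nat \<Rightarrow> nat set) \<Rightarrow> int mat" where
  "matrix_of_chain l n X =
     mat l n (\<lambda>(i, j). of_bool (Suc j \<in> X (Suc i)) - of_bool (Suc j \<in> X i))"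

lemma tableau_column_eq:
  "tableau_column la n A c = sorted_list_of_set (partial_sum_support n A (largest_part la - c))"
  by (simp add: tableau_column_def partial_sum_support_def)

lemma partial_sum_support_subset: "partial_sum_support n A m \<subseteq> {1..n}"
  by (auto simp: partial_sum_support_def)

text \<open>A column partial sum is 0 or 1, hence it is the indicator of being 1. The empty sum is
  treated apart because \<open>sign_matrix\<close> speaks of nonempty sums only.\<close>

lemma column_sum_eq_of_bool:
  assumes "sign_matrix A" "A \<in> carrier_mat l n" "m \<le> l" "j < n"
  shows "(\<Sum>k<m. A $$ (k, j)) = of_bool (Suc j \<in> partial_sum_support n A m)"
proof (cases m)
  case 0
  then show ?thesis by (simp add: partial_sum_support_def)
next
  case (Suc i)
  have "i < dim_row A" "j < dim_col A" using assms Suc by auto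
  then have "(\<Sum>k\<le>i. A $$ (k, j)) \<in> {0, 1}" using assms(1) unfolding sign_matrix_def by blast
  then show ?thesis using Suc assms(4) by (auto simp: partial_sum_support_def lessThan_Suc_atMost)
qed

text \<open>Each entry is the difference of two successive column partial sums, that is, of two
  indicators; summing along the row counts elements.\<close>

lemma sum_row_eq_card_diff:
  assumes A: "sign_matrix A" "A \<in> carrier_mat l n" and "i < l" "j \<le> n"
  shows "(\<Sum>k<j. A $$ (i, k)) = int (card (partial_sum_support n A (Suc i) \<inter> {..j}))
    - int (card (partial_sum_support n A i \<inter> {..j}))"
proof -
  have "A $$ (i, k) = of_bool (Suc k \<in> partial_sum_support n A (Suc i))
      - of_bool (Suc k \<in> partial_sum_support n A i)" if "k < j" for k
    using column_sum_eq_of_bool[OF A, of "Suc i" k] column_sum_eq_of_bool[OF A, of i k]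
      that assms(3,4) by simp
  moreover have "0 \<notin> partial_sum_support n A m" for m by (simp add: partial_sum_support_def)
  ultimately show ?thesis by (simp add: card_Int_atMost_eq_sum sum_subtractf)
qed

lemma partial_sum_support_dominance_chain:
  assumes la: "is_partition la" and A: "A \<in> sign_matrices la n"
  shows "partial_sum_support n A \<in> dominance_chains la n"
proof -
  let ?l = "largest_part la"
  let ?X = "partial_sum_support n A"
  have sm: "sign_matrix A" and dim: "A \<in> carrier_mat ?l n"
    and row: "\<And>i. i < ?l \<Longrightarrow> (\<Sum>j<n. A $$ (i, j)) = int (frequency la (?l - i))"
    using A by (auto simp: sign_matrices_def)
  have Int_n: "?X m \<inter> {..n} = ?X m" for m using partial_sum_support_subset by fastforce
  have card: "card (?X m) = column_length la (?l - m)" if "m \<le> ?l" for m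
    using that
  proof (induction m)
    case 0
    then show ?case
      using column_length_largest_part[OF la] by (simp add: partial_sum_support_def)
  next
    case (Suc m)
    then have "int (card (?X (Suc m))) = int (card (?X m)) + int (frequency la (?l - m))"
      using sum_row_eq_card_diff[OF sm dim, of m n] row[of m] by (simp add: Int_n)
    \<comment> \<open>The parts equal to \<open>?l - m\<close> account exactly for the step from the
      length of column \<open>?l - m\<close> to that of column \<open>?l - Suc m\<close>.\<close>
    moreover have "?l - m = Suc (?l - Suc m)" using Suc.prems by simp
    ultimately show ?case
      using Suc column_length_Suc[of la "?l - Suc m"] by simp
  qed
  have dom: "card (?X m \<inter> {..x}) \<le> card (?X (Suc m) \<inter> {..x})" if m: "m < ?l" for m x
  proof -
    \<comment> \<open>Row sums exist only up to column \<open>n\<close>; as the supports lie in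
      \<open>{1..n}\<close>, any bound may be cut down to that range.\<close>
    have min: "?X m \<inter> {..x} = ?X m \<inter> {..min x n}" for m
      using partial_sum_support_subset[of n A m] by auto
    have "0 \<le> (\<Sum>k<j. A $$ (m, k))" if "j \<le> n" for j
    proof (cases j)
      case (Suc j')
      have "m < dim_row A" "j' < dim_col A" using Suc m dim that by auto
      then show ?thesis using sm Suc unfolding sign_matrix_def by (simp add: lessThan_Suc_atMost)
    qed simp
    from this[of "min x n"] sum_row_eq_card_diff[OF sm dim m, of "min x n"]
    show ?thesis by (simp add: min)
  qed
  show ?thesis
    unfolding dominance_chains_def using card dom partial_sum_support_subset by blast
qed

lemma matrix_of_chain_partial_sum_support:
  assumes "A \<in> sign_matrices la n"
  shows "matrix_of_chain (largest_part la) n (partial_sum_support n A) = A"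
proof (rule eq_matI)
  have sm: "sign_matrix A" and dim: "A \<in> carrier_mat (largest_part la) n"
    using assms by (auto simp: sign_matrices_def)
  then show "dim_row (matrix_of_chain (largest_part la) n (partial_sum_support n A)) = dim_row A"
    "dim_col (matrix_of_chain (largest_part la) n (partial_sum_support n A)) = dim_col A"
    by (auto simp: matrix_of_chain_def)
  fix i j assume "i < dim_row A" "j < dim_col A"
  then have ij: "i < largest_part la" "j < n" using dim by auto
  then show "matrix_of_chain (largest_part la) n (partial_sum_support n A) $$ (i, j) = A $$ (i, j)"
    using column_sum_eq_of_bool[OF sm dim, of "Suc i" j] column_sum_eq_of_bool[OF sm dim, of i j]
    by (simp add: matrix_of_chain_def)
qed

text \<open>The sum telescopes, and \<open>X 0 = {}\<close> removes the lower boundary term.\<close>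

lemma matrix_of_chain_column_sum:
  assumes "X 0 = {}" "m \<le> l" "j < n"
  shows "(\<Sum>k<m. matrix_of_chain l n X $$ (k, j)) = of_bool (Suc j \<in> X m)"
  using assms(2) by (induction m) (use assms in \<open>auto simp: matrix_of_chain_def\<close>)

lemma dominance_chain_0:
  assumes "is_partition la" "X \<in> dominance_chains la n"
  shows "X 0 = {}"
proof -
  have "X 0 \<subseteq> {1..n}" "card (X 0) = 0"
    using assms column_length_largest_part by (auto simp: dominance_chains_def)
  then show ?thesis using finite_subset by fastforce
qed

lemma partial_sum_support_matrix_of_chain:
  assumes "is_partition la" and X: "X \<in> dominance_chains la n" and m: "m \<le> largest_part la"
  shows "partial_sum_support n (matrix_of_chain (largest_part la) n X) m = X m"
proof -
  have "X m \<subseteq> {1..n}" using X m by (simp add: dominance_chains_def)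
  then have "\<exists>j. x = Suc j \<and> j < n" if "x \<in> X m" for x
    using that by (cases x) auto
  moreover have "(\<Sum>k<m. matrix_of_chain (largest_part la) n X $$ (k, j)) = 1 \<longleftrightarrow> Suc j \<in> X m"
    if "j < n" for j
    using matrix_of_chain_column_sum[of X, OF dominance_chain_0[OF assms(1) X] m that] by simp
  ultimately show ?thesis unfolding partial_sum_support_def by blast
qed

text \<open>Column sums telescope to indicators, row sums become differences of counts. Dominance
  makes the latter nonnegative, and the prescribed cardinalities give the row totals.\<close>

lemma matrix_of_chain_sign_matrix:
  assumes la: "is_partition la" and X: "X \<in> dominance_chains la n"
  shows "matrix_of_chain (largest_part la) n X \<in> sign_matrices la n"
proof -
  let ?l = "largest_part la"
  let ?A = "matrix_of_chain ?l n X"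
  have sub: "X m \<subseteq> {1..n}" and card: "card (X m) = column_length la (?l - m)" if "m \<le> ?l" for m
    using X that by (auto simp: dominance_chains_def)
  have dom: "card (X m \<inter> {..x}) \<le> card (X (Suc m) \<inter> {..x})" if "m < ?l" for m x
    using X that by (auto simp: dominance_chains_def)
  have X0: "X 0 = {}" by (rule dominance_chain_0[OF assms])
  have dim: "?A \<in> carrier_mat ?l n" by (simp add: matrix_of_chain_def)
  have row: "(\<Sum>k<j. ?A $$ (i, k)) = int (card (X (Suc i) \<inter> {..j})) - int (card (X i \<inter> {..j}))"
    if "i < ?l" "j \<le> n" for i j
  proof -
    have "0 \<notin> X i" "0 \<notin> X (Suc i)" using sub[of i] sub[of "Suc i"] that by auto
    then show ?thesis using that
      by (simp add: card_Int_atMost_eq_sum matrix_of_chain_def sum_subtractf)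
  qed
  have "sign_matrix ?A"
    unfolding sign_matrix_def
  proof (intro conjI allI impI)
    fix i j assume "i < dim_row ?A" "j < dim_col ?A"
    then have i: "i < ?l" and j: "j < n" using dim by auto
    show "?A $$ (i, j) \<in> {-1, 0, 1}" using i j by (simp add: matrix_of_chain_def)
    show "(\<Sum>k\<le>i. ?A $$ (k, j)) \<in> {0, 1}"
      using matrix_of_chain_column_sum[of X "Suc i" ?l j n, OF X0] i j
      by (simp add: lessThan_Suc_atMost del: sum.lessThan_Suc)
    show "0 \<le> (\<Sum>k\<le>j. ?A $$ (i, k))"
      using row[OF i, of "Suc j"] j dom[OF i, of "Suc j"]
      by (simp add: lessThan_Suc_atMost del: sum.lessThan_Suc)
  qed
  moreover have "(\<Sum>j<n. ?A $$ (i, j)) = int (frequency la (?l - i))" if i: "i < ?l" for i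
  proof -
    have "X i \<inter> {..n} = X i" "X (Suc i) \<inter> {..n} = X (Suc i)"
      using sub[of i] sub[of "Suc i"] i by auto
    moreover have "?l - i = Suc (?l - Suc i)" using i by simp
    ultimately show ?thesis
      using row[OF i, of n] card[of i] card[of "Suc i"] i column_length_Suc[of la "?l - Suc i"]
      by simp
  qed
  ultimately show ?thesis using dim by (simp add: sign_matrices_def)
qed

section \<open>Tableaux as chains of sets\<close>

text \<open>The order is reversed: the sets of the chain grow with the index, while the columns of
  the diagram get shorter to the right.\<close>

definition tableau_of_chain :: "nat list \<Rightarrow> (nat \<Rightarrow> nat set) \<Rightarrow> nat list list" where
  "tableau_of_chain la X =
     map (\<lambda>r. map (\<lambda>c. sorted_list_of_set (X (largest_part la - c)) ! r) [0..<la ! r])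
       [0..<length la]"

definition column_entries :: "nat list list \<Rightarrow> nat \<Rightarrow> nat set" where
  "column_entries T c = {T ! r ! c |r. r < length T \<and> c < length (T ! r)}"

definition chain_of_tableau :: "nat list \<Rightarrow> nat list list \<Rightarrow> nat \<Rightarrow> nat set" where
  "chain_of_tableau la T m = column_entries T (largest_part la - m)"

lemma tableau_of_sign_matrix_eq:
  "tableau_of_sign_matrix la n A = tableau_of_chain la (partial_sum_support n A)"
  by (simp add: tableau_of_sign_matrix_def tableau_of_chain_def tableau_column_eq)

lemma tableau_of_chain_nth:
  assumes "r < length la" "c < la ! r"
  shows "tableau_of_chain la X ! r ! c = sorted_list_of_set (X (largest_part la - c)) ! r"
  using assms by (simp add: tableau_of_chain_def)

lemma map_length_tableau_of_chain: "map length (tableau_of_chain la X) = la"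
  by (simp add: tableau_of_chain_def comp_def map_nth)

lemma less_largest_part:
  "is_partition la \<Longrightarrow> r < length la \<Longrightarrow> c < la ! r \<Longrightarrow> c < largest_part la"
  using part_le_largest_part[of la "la ! r"] by simp

lemma tableau_of_chain_SSYT:
  assumes la: "is_partition la" and X: "X \<in> dominance_chains la n"
  shows "tableau_of_chain la X \<in> SSYT la n"
proof -
  let ?l = "largest_part la"
  let ?T = "tableau_of_chain la X"
  let ?Y = "\<lambda>c. X (?l - c)"
  have sub: "?Y c \<subseteq> {1..n}" and card: "card (?Y c) = column_length la c" if "c \<le> ?l" for c
    using X that by (auto simp: dominance_chains_def)
  have fin: "finite (?Y c)" if "c \<le> ?l" for c using sub[OF that] finite_subset by blast
  have len: "length ?T = length la" "\<And>r. r < length la \<Longrightarrow> length (?T ! r) = la ! r"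
    by (auto simp: tableau_of_chain_def)
  \<comment> \<open>For every cell of the diagram, \<open>r\<close> is a valid index of the sorted
    list for column \<open>c\<close>; otherwise the value of \<open>!\<close> would be
    unspecified.\<close>
  have less_card: "c \<le> ?l" "r < card (?Y c)" if "r < length la" "c < la ! r" for r c
    using less_largest_part[OF la that] card less_nth_iff_less_column_length[OF la that(1)] that
    by auto
  have "?T ! r ! c \<in> {1..n}" if rc: "r < length la" "c < la ! r" for r c
  proof -
    have "sorted_list_of_set (?Y c) ! r \<in> set (sorted_list_of_set (?Y c))"
      using less_card[OF rc] by (intro nth_mem) simp
    then show ?thesis
      using sub[OF less_card(1)[OF rc]] fin[OF less_card(1)[OF rc]]
      by (auto simp: tableau_of_chain_nth[OF rc])
  qed
  then have entries: "\<forall>row\<in>set ?T. set row \<subseteq> {1..n}"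
    by (fastforce simp: in_set_conv_nth len)
  \<comment> \<open>Dominance between neighbouring columns gives entrywise comparison; adjacent
    entries suffice for sortedness of a row.\<close>
  have "?T ! r ! c \<le> ?T ! r ! Suc c" if r: "r < length la" and c: "Suc c < la ! r" for r c
  proof -
    have "Suc c \<le> ?l" "r < card (?Y (Suc c))" using less_card[OF r c] by auto
    moreover have "?l - c = Suc (?l - Suc c)" using \<open>Suc c \<le> ?l\<close> by simp
    then have "card (?Y (Suc c) \<inter> {..x}) \<le> card (?Y c \<inter> {..x})" for x
      using X \<open>Suc c \<le> ?l\<close> by (simp add: dominance_chains_def)
    moreover have "card (?Y (Suc c)) \<le> card (?Y c)"
      using card[of c] card[of "Suc c"] column_length_Suc[of la c] \<open>Suc c \<le> ?l\<close> by simp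
    ultimately have "sorted_list_of_set (?Y c) ! r \<le> sorted_list_of_set (?Y (Suc c)) ! r"
      using sorted_list_of_set_dominance[OF fin fin, of c "Suc c"] by simp
    then show ?thesis using r c by (simp add: tableau_of_chain_nth)
  qed
  then have rows: "\<forall>row\<in>set ?T. sorted_wrt (\<le>) row"
    by (auto simp: in_set_conv_nth len sorted_iff_nth_Suc)
  have cols: "?T ! r ! c < ?T ! r' ! c" if "r < r'" "r' < length la" and c: "c < la ! r'" for r r' c
  proof -
    have rc: "c < la ! r"
      using less_nth_iff_less_column_length[OF la, of r c]
        less_nth_iff_less_column_length[OF la, of r' c] that by simp
    have "r' < length (sorted_list_of_set (?Y c))" using less_card[OF that(2) c] by simp
    then have "sorted_list_of_set (?Y c) ! r < sorted_list_of_set (?Y c) ! r'"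
      using strict_sorted_list_of_set[of "?Y c"] that(1) by (simp add: sorted_wrt_iff_nth_less)
    then show ?thesis using that rc by (simp add: tableau_of_chain_nth)
  qed
  show ?thesis
    unfolding SSYT_def using map_length_tableau_of_chain entries rows cols len by auto
qed

text \<open>Column \<open>c\<close> of the diagram has exactly \<open>card (X m)\<close> cells, so
  the tableau uses the whole sorted list and no element of \<open>X m\<close> is lost.\<close>

lemma chain_of_tableau_of_chain:
  assumes la: "is_partition la" and X: "X \<in> dominance_chains la n" and m: "m \<le> largest_part la"
  shows "chain_of_tableau la (tableau_of_chain la X) m = X m"
proof -
  let ?T = "tableau_of_chain la X"
  define c where "c = largest_part la - m"
  have m_eq: "largest_part la - c = m" using m by (simp add: c_def)
  have sub: "X m \<subseteq> {1..n}" and card: "card (X m) = column_length la c"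
    using X m by (auto simp: dominance_chains_def c_def)
  have fin: "finite (X m)" using sub finite_subset by blast
  have len: "length ?T = length la" "\<And>r. r < length la \<Longrightarrow> length (?T ! r) = la ! r"
    by (auto simp: tableau_of_chain_def)
  have "column_entries ?T c = {sorted_list_of_set (X m) ! r |r. r < length la \<and> c < la ! r}"
    unfolding column_entries_def
    by (intro Collect_cong ex_cong1) (auto simp: len tableau_of_chain_nth m_eq)
  also have "\<dots> = {sorted_list_of_set (X m) ! r |r. r < card (X m)}"
  proof -
    have "r < length la \<and> c < la ! r \<longleftrightarrow> r < card (X m)" for r
      using less_nth_iff_less_column_length[OF la, of r c] column_length_le[of la c] card by auto
    then show ?thesis by simp
  qed
  also have "\<dots> = set (sorted_list_of_set (X m))"
    by (auto simp: set_conv_nth)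
  finally show ?thesis using fin by (simp add: chain_of_tableau_def c_def)
qed

text \<open>Read downwards, a column is strictly increasing, and a strictly sorted list is
  determined by its set. The column can therefore be recovered from its set of entries.\<close>

lemma SSYT_column:
  assumes la: "is_partition la" and T: "T \<in> SSYT la n"
  shows "sorted_list_of_set (column_entries T c) = map (\<lambda>r. T ! r ! c) [0..<column_length la c]"
    (is "_ = ?col")
    and "card (column_entries T c) = column_length la c"
proof -
  have "map length T = la" using T by (simp add: SSYT_def)
  then have len: "length T = length la" "\<And>r. r < length la \<Longrightarrow> length (T ! r) = la ! r"
    by auto
  have strict: "T ! r ! c < T ! r' ! c" if "r < r'" "r' < column_length la c" for r r'
  proof -
    have "r' < length la" using that column_length_le[of la c] by simp
    moreover have "c < la ! r'" using that less_nth_iff_less_column_length[OF la \<open>r' < length la\<close>] by simp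
    ultimately show ?thesis using T that(1) len by (simp add: SSYT_def)
  qed
  have "r < length T \<and> c < length (T ! r) \<longleftrightarrow> r < column_length la c" for r
    using less_nth_iff_less_column_length[OF la, of r c] column_length_le[of la c] len by auto
  then have "column_entries T c = {T ! r ! c |r. r < column_length la c}"
    by (simp add: column_entries_def)
  then have set: "column_entries T c = set ?col" by auto
  have sorted: "sorted_wrt (<) ?col" using strict by (simp add: sorted_wrt_iff_nth_less)
  show eq: "sorted_list_of_set (column_entries T c) = ?col"
    unfolding set using sorted
    by (metis strict_sorted_equal strict_sorted_list_of_set set_sorted_list_of_set finite_set)
  show "card (column_entries T c) = column_length la c"
    using arg_cong[OF eq, of length] by simp
qed

lemma tableau_of_chain_of_tableau:
  assumes la: "is_partition la" and T: "T \<in> SSYT la n"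
  shows "tableau_of_chain la (chain_of_tableau la T) = T"
proof -
  have "map length T = la" using T by (simp add: SSYT_def)
  then have len: "length T = length la" "\<And>r. r < length la \<Longrightarrow> length (T ! r) = la ! r"
    by auto
  have "tableau_of_chain la (chain_of_tableau la T) ! r ! c = T ! r ! c"
    if rc: "r < length la" "c < la ! r" for r c
  proof -
    have "r < column_length la c" using rc less_nth_iff_less_column_length[OF la] by blast
    then show ?thesis
      using less_largest_part[OF la rc]
      by (simp add: tableau_of_chain_nth[OF rc] chain_of_tableau_def SSYT_column(1)[OF la T])
  qed
  then show ?thesis
    by (intro nth_equalityI) (auto simp: len tableau_of_chain_def)
qed

text \<open>Here the dominance equivalence is used in the other direction: weak increase along rows
  compares adjacent columns entrywise, which yields the inequalities between counts.\<close>

lemma chain_of_tableau_dominance_chain: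
  assumes la: "is_partition la" and T: "T \<in> SSYT la n"
  shows "chain_of_tableau la T \<in> dominance_chains la n"
proof -
  let ?Y = "column_entries T"
  have "map length T = la" using T by (simp add: SSYT_def)
  then have len: "length T = length la" "\<And>r. r < length la \<Longrightarrow> length (T ! r) = la ! r"
    by auto
  have sub: "?Y c \<subseteq> {1..n}" for c
  proof -
    have "T ! r ! c \<in> {1..n}" if "r < length T" "c < length (T ! r)" for r
      using T nth_mem[OF that(1)] nth_mem[OF that(2)] unfolding SSYT_def by blast
    then show ?thesis by (auto simp: column_entries_def)
  qed
  have fin: "finite (?Y c)" for c using sub finite_subset by blast
  have dom: "card (?Y (Suc c) \<inter> {..x}) \<le> card (?Y c \<inter> {..x})" for c x
  proof -
    have le: "column_length la (Suc c) \<le> column_length la c" using column_length_Suc[of la c] by simp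
    have "T ! r ! c \<le> T ! r ! Suc c" if r: "r < column_length la (Suc c)" for r
    proof -
      have r': "r < length la" using r column_length_le[of la "Suc c"] by simp
      then have "Suc c < la ! r" using r less_nth_iff_less_column_length[OF la] by blast
      moreover have "sorted (T ! r)" using T r' len by (simp add: SSYT_def)
      ultimately show ?thesis using len(2)[OF r'] by (simp add: sorted_iff_nth_Suc)
    qed
    then show ?thesis
      using sorted_list_of_set_dominance[OF fin fin, of "Suc c" c] le
      by (simp add: SSYT_column[OF la T])
  qed
  have "card (?Y (largest_part la - m) \<inter> {..x}) \<le> card (?Y (largest_part la - Suc m) \<inter> {..x})"
    if "m < largest_part la" for m x
    using dom[of "largest_part la - Suc m" x] that by (simp add: Suc_diff_Suc)
  then show ?thesis
    using sub SSYT_column(2)[OF la T] by (simp add: dominance_chains_def chain_of_tableau_def)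
qed

section \<open>Composition of the two correspondences\<close>

theorem theorem2p10:
  fixes la :: "nat list" and n :: nat
  assumes "is_partition la" and "0 < n"
  shows "bij_betw (tableau_of_sign_matrix la n) (sign_matrices la n) (SSYT la n)"
proof (rule bij_betw_byWitness)
  let ?l = "largest_part la"
  \<comment> \<open>The inverse collects the columns of the tableau into a chain of sets and takes
    differences of successive indicators.\<close>
  let ?g = "\<lambda>T. matrix_of_chain ?l n (chain_of_tableau la T)"
  note la = assms(1)
  \<comment> \<open>The round trips through chains give agreement only up to \<open>?l\<close>, so
    both constructions must be shown to depend on these values alone.\<close>
  have matrix_cong: "matrix_of_chain ?l n X = matrix_of_chain ?l n Y"
    if "\<And>m. m \<le> ?l \<Longrightarrow> X m = Y m" for X Y
    using that by (intro eq_matI) (auto simp: matrix_of_chain_def)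
  have tableau_cong: "tableau_of_chain la X = tableau_of_chain la Y"
    if "\<And>m. m \<le> ?l \<Longrightarrow> X m = Y m" for X Y
    using that by (simp add: tableau_of_chain_def)
  show "\<forall>A\<in>sign_matrices la n. ?g (tableau_of_sign_matrix la n A) = A"
  proof
    fix A assume A: "A \<in> sign_matrices la n"
    have "?g (tableau_of_sign_matrix la n A) = matrix_of_chain ?l n (partial_sum_support n A)"
      unfolding tableau_of_sign_matrix_eq
      by (intro matrix_cong chain_of_tableau_of_chain[OF la, where n = n]
          partial_sum_support_dominance_chain[OF la A])
    then show "?g (tableau_of_sign_matrix la n A) = A"
      using matrix_of_chain_partial_sum_support[OF A] by simp
  qed
  show "\<forall>T\<in>SSYT la n. tableau_of_sign_matrix la n (?g T) = T"
  proof
    fix T assume T: "T \<in> SSYT la n"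
    have "tableau_of_sign_matrix la n (?g T) = tableau_of_chain la (chain_of_tableau la T)"
      unfolding tableau_of_sign_matrix_eq
      by (intro tableau_cong partial_sum_support_matrix_of_chain[OF la]
          chain_of_tableau_dominance_chain[OF la T])
    then show "tableau_of_sign_matrix la n (?g T) = T"
      using tableau_of_chain_of_tableau[OF la T] by simp
  qed
  show "tableau_of_sign_matrix la n ` sign_matrices la n \<subseteq> SSYT la n"
    using tableau_of_chain_SSYT[OF la] partial_sum_support_dominance_chain[OF la]
    by (auto simp: tableau_of_sign_matrix_eq)
  show "?g ` SSYT la n \<subseteq> sign_matrices la n"
    using matrix_of_chain_sign_matrix[OF la] chain_of_tableau_dominance_chain[OF la] by auto
qed

end
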